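(* Let $k$ be a field, $R=k[x_1,x_2,x_3,x_4]$, $\mathfrak{m}=(x_1,x_2,x_3,x_4)$, and let $I=(a_1,\ldots,a_5)$ be an $\mathfrak{m}$-primary ideal minimally generated by five quadrics, with $J=(a_1,a_2,a_3,a_4)$ a minimal reduction of $I$. Assume $I_1(\varphi)=\mathfrak{m}^2$, and let $\mathbf{B}$ be the $4\times4$ matrix with entries in $k[T_1,\ldots,T_5]$ defined in the context. Then $\det\mathbf{B}\neq 0$.
   Context: $\varphi$ is the matrix of syzygies of $I$ in a minimal graded free presentation and $I_1(\varphi)$ is the ideal generated by its entries. $J$ is a reduction of $I$ if $I^{q+1}=JI^q$ for some $q$. Let $S=R[T_1,\ldots,T_5]$, $L=\ker(S\to R[It])$, $T_i\mapsto a_it$; $L_i$, $S_i$ denote the components of degree $i$ in the $T$'s. Under the assumption $I_1(\varphi)=\mathfrak{m}^2$, the $R$-module $L_2/S_1L_1$ is minimally generated by the classes of four forms $\mathbf{q}_1,\mathbf{q}_2,\mathbf{q}_3,\mathbf{q}_4\in L_2$, quadratic in the $T$'s with coefficients that are linear forms of $R$; fix such forms. The matrix $\mathbf{B}$ is defined by $$[\mathbf{q}_1,\mathbf{q}_2,\mathbf{q}_3,\mathbf{q}_4]=[x_1,x_2,x_3,x_4]\cdot\mathbf{B}.$$ *)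

theory Defs
  imports "HOL-Analysis.Determinants" "HOL-Library.Poly_Mapping" "HOL-Computational_Algebra.Polynomial"
begin

section \<open>Polynomial rings\<close>

text \<open>
  \<^typ>\<open>'v \<Rightarrow>\<^sub>0 nat\<close> is the type of monomials in variables indexed by \<open>'v\<close>;
  the convolution product makes finitely supported functions on it the polynomial ring.
  Below, \<open>R = (4, 'k) mpol\<close>, \<open>S = R[T] = (5, (4, 'k) mpol) mpol\<close> and \<open>k[T] = (5, 'k) mpol\<close>;
  in the index type \<open>4\<close> one has \<open>4 = 0\<close>, and similarly \<open>5 = 0\<close> in the index type \<open>5\<close>,
  so the variables are indexed by \<open>1, \<dots>, 4\<close> and \<open>1, \<dots>, 5\<close> as usual.
\<close>

type_synonym ('v, 'c) mpol = "('v \<Rightarrow>\<^sub>0 nat) \<Rightarrow>\<^sub>0 'c"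

definition Cst :: "'c \<Rightarrow> ('v, 'c::zero) mpol" where
  "Cst c = Poly_Mapping.single 0 c"

definition Var :: "'v \<Rightarrow> ('v, 'c::zero_neq_one) mpol" where
  "Var i = Poly_Mapping.single (Poly_Mapping.single i 1) 1"

definition homogeneous :: "nat \<Rightarrow> ('v::finite, 'c::zero) mpol \<Rightarrow> bool" where
  "homogeneous d f \<longleftrightarrow> (\<forall>m\<in>Poly_Mapping.keys f. (\<Sum>i\<in>UNIV. Poly_Mapping.lookup m i) = d)"


section \<open>Ideals and minimal generators\<close>

lemma module_mult: "module ((*) :: 'r::comm_ring_1 \<Rightarrow> 'r \<Rightarrow> 'r)"
  by unfold_locales (simp_all add: algebra_simps)

lemma module_vec: "module ((*s) :: 'r::comm_ring_1 \<Rightarrow> 'r ^ 'n \<Rightarrow> 'r ^ 'n)"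
  by unfold_locales (simp_all add: vec_eq_iff algebra_simps)

definition Cst_scale :: "'r \<Rightarrow> ('v, 'r::comm_ring_1) mpol \<Rightarrow> ('v, 'r) mpol" where
  "Cst_scale r f = Cst r * f"

lemma module_Cst_scale:
  "module (Cst_scale :: 'r::comm_ring_1 \<Rightarrow> ('v, 'r) mpol \<Rightarrow> ('v, 'r) mpol)"
  by unfold_locales
    (simp_all add: Cst_scale_def Cst_def algebra_simps single_add mult_single flip: mult.assoc)

abbreviation is_ideal :: "'r::comm_ring_1 set \<Rightarrow> bool" where
  "is_ideal \<equiv> module.subspace (*)"

abbreviation ideal_span :: "'r::comm_ring_1 set \<Rightarrow> 'r set" where
  "ideal_span \<equiv> module.span (*)"

text \<open>
  The classes of the family \<open>g\<close> form an irredundant system of generators of \<open>M / N\<close>, for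
  submodules \<open>N \<subseteq> M\<close> of a module with scalar multiplication \<open>s\<close>.  It is used for homogeneous
  families in graded modules only, where irredundant systems of generators have the least
  possible number of elements.
\<close>

definition minimally_generates_quotient ::
  "('r::comm_ring_1 \<Rightarrow> 'm::ab_group_add \<Rightarrow> 'm) \<Rightarrow> ('i \<Rightarrow> 'm) \<Rightarrow> 'm set \<Rightarrow> 'm set \<Rightarrow> bool" where
  "minimally_generates_quotient s g M N \<longleftrightarrow>
     module.span s (range g \<union> N) = M \<and> (\<forall>j. g j \<notin> module.span s (g ` (UNIV - {j}) \<union> N))"

abbreviation minimally_generates ::
  "('r::comm_ring_1 \<Rightarrow> 'm::ab_group_add \<Rightarrow> 'm) \<Rightarrow> ('i \<Rightarrow> 'm) \<Rightarrow> 'm set \<Rightarrow> bool" where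
  "minimally_generates s g M \<equiv> minimally_generates_quotient s g M {0}"

definition ideal_mult :: "'r::comm_ring_1 set \<Rightarrow> 'r set \<Rightarrow> 'r set" where
  "ideal_mult A B = ideal_span {a * b | a b. a \<in> A \<and> b \<in> B}"

fun ideal_power :: "'r::comm_ring_1 set \<Rightarrow> nat \<Rightarrow> 'r set" where
  "ideal_power A 0 = UNIV"
| "ideal_power A (Suc n) = ideal_mult A (ideal_power A n)"

definition radical :: "'r::comm_ring_1 set \<Rightarrow> 'r set" where
  "radical A = {r. \<exists>n. r ^ n \<in> A}"

definition primary_ideal :: "'r::comm_ring_1 set \<Rightarrow> bool" where
  "primary_ideal Q \<longleftrightarrow> is_ideal Q \<and> Q \<noteq> UNIV \<and>
     (\<forall>a b. a * b \<in> Q \<longrightarrow> a \<in> Q \<or> (\<exists>n. b ^ n \<in> Q))"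

definition primary_to :: "'r::comm_ring_1 set \<Rightarrow> 'r set \<Rightarrow> bool" where
  "primary_to P Q \<longleftrightarrow> primary_ideal Q \<and> radical Q = P"

definition reduction :: "'r::comm_ring_1 set \<Rightarrow> 'r set \<Rightarrow> bool" where
  "reduction J I \<longleftrightarrow> is_ideal J \<and> J \<subseteq> I \<and>
     (\<exists>q. ideal_power I (q + 1) = ideal_mult J (ideal_power I q))"

definition minimal_reduction :: "'r::comm_ring_1 set \<Rightarrow> 'r set \<Rightarrow> bool" where
  "minimal_reduction J I \<longleftrightarrow> reduction J I \<and> (\<forall>K. reduction K I \<and> K \<subseteq> J \<longrightarrow> K = J)"

definition max_ideal :: "('v, 'c::comm_ring_1) mpol set" where
  "max_ideal = ideal_span (range Var)"


section \<open>Presentations\<close>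

definition syzygies :: "'r::comm_ring_1 ^ 'm \<Rightarrow> ('r ^ 'm) set" where
  "syzygies a = {s. (\<Sum>i\<in>UNIV. a $ i * s $ i) = 0}"

text \<open>
  \<open>\<phi>\<close> is the matrix of a minimal graded free presentation of the ideal minimally generated by
  the entries of \<open>a\<close>, which are forms of one and the same degree.  For that reason a column is
  homogeneous in the graded free module covering the ideal iff its entries are forms of one
  and the same degree.
\<close>

definition minimal_graded_presentation ::
  "('v::finite, 'c::comm_ring_1) mpol ^ 'm \<Rightarrow> ('v, 'c) mpol ^ 'n ^ 'm \<Rightarrow> bool" where
  "minimal_graded_presentation a \<phi> \<longleftrightarrow>
     (\<forall>j. \<exists>d. \<forall>i. homogeneous d (\<phi> $ i $ j)) \<and>
     minimally_generates (*s) (\<lambda>j. column j \<phi>) (syzygies a)"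

definition I1 :: "'r::comm_ring_1 ^ 'n ^ 'm \<Rightarrow> 'r set" where
  "I1 \<phi> = ideal_span {\<phi> $ i $ j | i j. True}"


section \<open>The Rees algebra\<close>

text \<open>
  The \<open>R\<close>-algebra map \<open>R[T] \<rightarrow> R[t]\<close>, \<open>T\<^sub>i \<mapsto> a\<^sub>i t\<close>, whose image is the Rees algebra of the
  ideal generated by the \<open>a\<^sub>i\<close>.
\<close>

definition rees_map :: "'r::comm_ring_1 ^ 'm \<Rightarrow> ('m::finite, 'r) mpol \<Rightarrow> 'r poly" where
  "rees_map a f = (\<Sum>m\<in>Poly_Mapping.keys f.
     [:Poly_Mapping.lookup f m:] * (\<Prod>i\<in>UNIV. monom (a $ i) 1 ^ Poly_Mapping.lookup m i))"

definition S_comp :: "nat \<Rightarrow> ('m::finite, 'r::comm_ring_1) mpol set" where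
  "S_comp d = {f. homogeneous d f}"

definition L_comp :: "'r::comm_ring_1 ^ 'm \<Rightarrow> nat \<Rightarrow> ('m::finite, 'r) mpol set" where
  "L_comp a d = {f \<in> S_comp d. rees_map a f = 0}"

definition S1L1 :: "'r::comm_ring_1 ^ 'm \<Rightarrow> ('m::finite, 'r) mpol set" where
  "S1L1 a = module.span Cst_scale {s * l | s l. s \<in> S_comp 1 \<and> l \<in> L_comp a 1}"

text \<open>The inclusion \<open>k[T] \<rightarrow> R[T]\<close>.\<close>

definition kT_to_S :: "('m, 'k::comm_ring_1) mpol \<Rightarrow> ('m, ('v, 'k) mpol) mpol" where
  "kT_to_S f = Poly_Mapping.map Cst f"

end

theory Submission
  imports Defs
begin

text \<open>
  Only the coefficients of \<open>T\<^sub>5\<^sup>2\<close> matter.  The entries of \<open>B\<close> are quadratic forms in the \<open>T\<^sub>i\<close>; let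
  \<open>B\<^sub>0\<close> be the matrix over \<open>k\<close> of their coefficients at \<open>T\<^sub>5\<^sup>2\<close>, that is, the value of \<open>B\<close> at
  \<open>T = (0, 0, 0, 0, 1)\<close>.  Then \<open>det B\<^sub>0\<close> is the value of \<open>det B\<close> there, and it suffices that \<open>B\<^sub>0\<close> has
  trivial kernel.

  Let \<open>B\<^sub>0 c = 0\<close>.  Then the quadric \<open>f = \<Sum>\<^sub>j c\<^sub>j q\<^sub>j \<in> L\<^sub>2\<close> has no term in \<open>T\<^sub>5\<^sup>2\<close>, so
  \<open>f = \<Sum>\<^sub>i T\<^sub>i p\<^sub>i\<close> with \<open>i\<close> running over \<open>1, \<dots>, 4\<close> only and linear \<open>p\<^sub>i\<close>.  Substituting \<open>a\<^sub>i\<close> for \<open>T\<^sub>i\<close> turns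
  this into a syzygy \<open>\<Sum>\<^sub>i a\<^sub>i b\<^sub>i = 0\<close> of \<open>a\<^sub>1, \<dots>, a\<^sub>4\<close>.  If that syzygy is a combination
  \<open>b\<^sub>i = \<Sum>\<^sub>j a\<^sub>j K\<^sub>j\<^sub>i\<close> of Koszul syzygies, with \<open>K\<close> alternating, then \<open>p\<^sub>i - \<Sum>\<^sub>j K\<^sub>j\<^sub>i T\<^sub>j\<close> is in \<open>L\<^sub>1\<close>,
  and replacing \<open>p\<^sub>i\<close> by it does not change \<open>f\<close>, as \<open>\<Sum>\<^sub>i\<^sub>j K\<^sub>j\<^sub>i T\<^sub>i T\<^sub>j = 0\<close>.  Hence
  \<open>f \<in> S\<^sub>1 L\<^sub>1\<close> (\<open>quadric_in_S1L1\<close>), which contradicts the minimality of the \<open>q\<^sub>j\<close> unless \<open>c = 0\<close>.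

  It remains to see that \<open>a\<^sub>1, \<dots>, a\<^sub>4\<close> have only Koszul syzygies.  The ideal \<open>J\<close> is a reduction of
  an ideal that is primary to the maximal ideal, so \<open>J\<close> contains powers \<open>g\<^sub>i\<close> of the variables
  (\<open>radical_reduction\<close>), and these form a regular sequence of length four.  Write
  \<open>H\<^sub>d(M)\<close> for the Koszul homology of \<open>a\<^sub>1, \<dots>, a\<^sub>4\<close> on a module \<open>M\<close>.  An element \<open>g \<in> J\<close>
  kills it; if \<open>g\<close> is also a nonzerodivisor on \<open>M\<close>, then the long exact sequence of multiplication
  by \<open>g\<close> gives a surjection \<open>H\<^sub>d\<^sub>+\<^sub>1(M / gM) \<rightarrow> H\<^sub>d(M)\<close>.  Dividing by the four \<open>g\<^sub>i\<close> one after the other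
  leads from \<open>H\<^sub>1(R)\<close> to \<open>H\<^sub>5\<close>, which vanishes because there are only four \<open>a\<^sub>i\<close>
  (\<open>koszul_acyclic_step\<close>, \<open>syzygies_of_system_of_parameters\<close>).  This is the
  depth sensitivity of the Koszul complex, by which every system of parameters of a
  Cohen-Macaulay local ring is regular.
\<close>

section \<open>Alternating functions and the Koszul complex\<close>

lemmas ideal_0 = module.subspace_0[OF module_mult]
lemmas ideal_add = module.subspace_add[OF module_mult]
lemmas ideal_diff = module.subspace_diff[OF module_mult]
lemmas ideal_scale = module.subspace_scale[OF module_mult]
lemmas ideal_sum = module.subspace_sum[OF module_mult]

text \<open>
  A \<open>k\<close>-chain of a Koszul complex is encoded as an alternating function on lists of length \<open>k\<close>.  One
  function carries chains of all degrees, so that no signs of positions have to be tracked: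
  all operations act at the head of a list.  Both clauses are stated, since
  in characteristic two the first does not imply the second.
\<close>

definition alternating :: "('i list \<Rightarrow> 'r::ab_group_add) \<Rightarrow> bool" where
  "alternating z \<longleftrightarrow>
     (\<forall>us x y vs. z (us @ x # y # vs) = - z (us @ y # x # vs)) \<and>
     (\<forall>us x vs. z (us @ x # x # vs) = 0)"

lemma alternatingD:
  assumes "alternating z"
  shows "z (us @ x # y # vs) = - z (us @ y # x # vs)" "z (us @ x # x # vs) = 0"
  using assms unfolding alternating_def by blast+

lemma alternating_Nil:
  assumes "alternating z"
  shows "z (x # y # vs) = - z (y # x # vs)" "z (x # x # vs) = 0"
  using alternatingD(1)[OF assms, of "[]" x y vs] alternatingD(2)[OF assms, of "[]" x vs]
  unfolding append_Nil by blast+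

lemma alternating_Cons:
  assumes "alternating z"
  shows "alternating (\<lambda>xs. z (i # xs))"
  unfolding alternating_def
proof (intro conjI allI)
  fix us x y vs
  note alt = alternatingD[OF assms, of "i # us", unfolded append_Cons]
  show "z (i # us @ x # y # vs) = - z (i # us @ y # x # vs)" "z (i # us @ x # x # vs) = 0"
    by (rule alt)+
qed

lemma alternating_diff:
  assumes z: "alternating z" and w: "alternating w"
  shows "alternating (\<lambda>xs. z xs - w xs)"
  unfolding alternating_def
proof (intro conjI allI)
  fix us x y vs
  show "z (us @ x # y # vs) - w (us @ x # y # vs) = - (z (us @ y # x # vs) - w (us @ y # x # vs))"
    by (subst alternatingD(1)[OF z], subst alternatingD(1)[OF w]) simp
  show "z (us @ x # x # vs) - w (us @ x # x # vs) = 0"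
    by (simp add: alternatingD(2)[OF z] alternatingD(2)[OF w])
qed

text \<open>
  Adjacent transpositions bring the two equal entries together.  This is why the Koszul complex
  on \<open>n\<close> elements ends in degree \<open>n\<close>.
\<close>

lemma alternating_repeated:
  assumes "alternating z" "\<not> distinct xs"
  shows "z xs = 0"
proof -
  have "z (us @ x # vs @ x # ws) = 0" for us x vs ws
  proof (induction vs arbitrary: us)
    case Nil
    show ?case using alternatingD(2)[OF assms(1)] by simp
  next
    case (Cons v vs)
    have "z (us @ v # x # vs @ x # ws) = 0"
      using Cons[of "us @ [v]"] by simp
    then show ?case
      by (simp add: alternatingD(1)[OF assms(1), of us x v])
  qed
  moreover obtain us x vs ws where "xs = us @ x # vs @ x # ws"
    using not_distinct_decomp[OF assms(2)] by auto
  ultimately show ?thesis by simp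
qed

text \<open>
  The terms at \<open>(i, j)\<close> and \<open>(j, i)\<close> cancel.  The lemma serves twice: it makes the Koszul
  differential square to zero, and it shows that Koszul relations are trivial quadrics.
\<close>

lemma alternating_form_zero:
  fixes y :: "'i \<Rightarrow> 's::comm_ring_1"
  assumes fin: "finite A"
    and anti: "\<And>i j. w i j = - w j i" and diag: "\<And>i. w i i = 0"
  shows "(\<Sum>i\<in>A. \<Sum>j\<in>A. y i * y j * w i j) = 0"
  using fin
proof (induction A)
  case (insert a A)
  have "y i * y a * w i a = - (y a * y i * w a i)" for i
    by (subst anti[of i a]) (simp only: mult.commute[of "y a" "y i"] mult_minus_right)
  then have "(\<Sum>i\<in>A. y i * y a * w i a) = - (\<Sum>j\<in>A. y a * y j * w a j)"
    by (simp only: sum_negf)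
  moreover have "(\<Sum>i\<in>insert a A. \<Sum>j\<in>insert a A. y i * y j * w i j) =
      (\<Sum>j\<in>A. y a * y j * w a j) + ((\<Sum>i\<in>A. y i * y a * w i a) + (\<Sum>i\<in>A. \<Sum>j\<in>A. y i * y j * w i j))"
    using insert.hyps by (simp add: diag sum.distrib)
  ultimately show ?case by (simp only: insert.IH) simp
qed simp

text \<open>The Koszul differential of the family \<open>f\<close> over \<open>A\<close>.\<close>

definition contract :: "'i set \<Rightarrow> ('i \<Rightarrow> 'r::comm_ring_1) \<Rightarrow> ('i list \<Rightarrow> 'r) \<Rightarrow> 'i list \<Rightarrow> 'r" where
  "contract A f z xs = (\<Sum>j\<in>A. f j * z (j # xs))"

text \<open>
  Exterior multiplication by the 1-chain \<open>c\<close>, i.e. the alternating sum of \<open>c\<close> at one entry times \<open>z\<close> at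
  the remaining list, arranged as a recursion on the head.
\<close>

fun wedge :: "('i \<Rightarrow> 'r::comm_ring_1) \<Rightarrow> ('i list \<Rightarrow> 'r) \<Rightarrow> 'i list \<Rightarrow> 'r" where
  "wedge c z [] = 0"
| "wedge c z (i # xs) = c i * z xs - wedge c (\<lambda>ys. z (i # ys)) xs"

lemma alternating_contract:
  assumes "alternating z"
  shows "alternating (contract A f z)"
  unfolding alternating_def contract_def
proof (intro conjI allI)
  fix us vs and x y
  have "z ((j # us) @ x # y # vs) = - z ((j # us) @ y # x # vs)" for j
    by (rule alternatingD[OF assms])
  then show "(\<Sum>j\<in>A. f j * z (j # us @ x # y # vs)) = - (\<Sum>j\<in>A. f j * z (j # us @ y # x # vs))"
    by (simp add: sum_negf[symmetric])
  have "z ((j # us) @ x # x # vs) = 0" for j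
    by (rule alternatingD[OF assms])
  then show "(\<Sum>j\<in>A. f j * z (j # us @ x # x # vs)) = 0"
    by simp
qed

lemma contract_contract:
  assumes "finite A" "alternating z"
  shows "contract A f (contract A f z) xs = 0"
proof -
  have "contract A f (contract A f z) xs = (\<Sum>i\<in>A. \<Sum>j\<in>A. f i * f j * z (j # i # xs))"
    by (simp add: contract_def sum_distrib_left mult.assoc)
  also have "\<dots> = 0"
    by (rule alternating_form_zero[OF assms(1), where w = "\<lambda>i j. z (j # i # xs)"])
       (rule alternating_Nil[OF assms(2)])+
  finally show ?thesis .
qed

lemma wedge_zero: "wedge c (\<lambda>_. 0) xs = 0"
  by (induction xs) simp_all

lemma wedge_uminus: "wedge c (\<lambda>ys. - z ys) xs = - wedge c z xs"
  by (induction xs arbitrary: z) simp_all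

lemma wedge_sum:
  "wedge c (\<lambda>ys. \<Sum>j\<in>A. f j * z j ys) xs = (\<Sum>j\<in>A. f j * wedge c (z j) xs)"
proof (induction xs arbitrary: z)
  case (Cons i xs)
  show ?case
    using Cons[of "\<lambda>j ys. z j (i # ys)"]
    by (simp add: sum_distrib_left right_diff_distrib sum_subtractf mult.left_commute)
qed simp

lemma alternating_wedge:
  assumes "alternating z"
  shows "alternating (wedge c z)"
proof -
  have "wedge c z (us @ x # y # vs) = - wedge c z (us @ y # x # vs) \<and> wedge c z (us @ x # x # vs) = 0"
    for us x y vs
    using assms
  proof (induction us arbitrary: z)
    case Nil
    note alt = alternating_Nil[OF Nil]
    have "(\<lambda>ys. z (x # y # ys)) = (\<lambda>ys. - z (y # x # ys))"
      using alt(1) by blast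
    then have "wedge c (\<lambda>ys. z (x # y # ys)) vs = - wedge c (\<lambda>ys. z (y # x # ys)) vs"
      by (simp only: wedge_uminus)
    then show ?case by (simp add: alt(2) wedge_zero)
  next
    case (Cons u us)
    have "z (us @ x # y # vs) = - z (us @ y # x # vs)" "z (us @ x # x # vs) = 0"
      by (rule alternatingD[OF Cons.prems])+
    then show ?case
      using Cons.IH[OF alternating_Cons[OF Cons.prems, of u]] by (auto simp: algebra_simps)
  qed
  then show ?thesis unfolding alternating_def by blast
qed

text \<open>
  Multiplication by \<open>g = \<Sum>\<^sub>j f\<^sub>j c\<^sub>j\<close> is null-homotopic on the Koszul complex of \<open>f\<close>, with
  exterior multiplication by \<open>c\<close> as homotopy: elements of the ideal of \<open>f\<close> kill Koszul homology.
\<close>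

lemma contract_wedge:
  "contract A f (wedge c z) xs = (\<Sum>j\<in>A. f j * c j) * z xs - wedge c (contract A f z) xs"
  unfolding contract_def
  by (simp add: wedge_sum right_diff_distrib sum_subtractf sum_distrib_right mult.assoc)

lemma wedge_in_ideal:
  assumes G: "is_ideal G"
    and z: "\<And>ys. set ys \<subseteq> A \<Longrightarrow> Suc (length ys) = length xs \<Longrightarrow> z ys \<in> G"
    and xs: "set xs \<subseteq> A"
  shows "wedge c z xs \<in> G"
  using z xs
proof (induction xs arbitrary: z)
  case Nil
  show ?case using ideal_0[OF G] by simp
next
  case (Cons i xs)
  have "c i * z xs \<in> G"
    using Cons.prems by (intro ideal_scale[OF G]) auto
  moreover have "wedge c (\<lambda>ys. z (i # ys)) xs \<in> G"
    using Cons.prems by (intro Cons.IH) auto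
  ultimately show ?case by (simp add: ideal_diff[OF G])
qed

text \<open>
  The Koszul homology of \<open>f\<close> with coefficients in \<open>R / G\<close> vanishes in degree \<open>k + 1\<close>.  Chains over the
  quotient are represented by chains over \<open>R\<close>.  The degree is shifted because the homology in degree \<open>0\<close> is
  \<open>R / (G + (f))\<close>, which vanishes only in trivial cases.
\<close>

definition koszul_acyclic :: "'i set \<Rightarrow> ('i \<Rightarrow> 'r::comm_ring_1) \<Rightarrow> 'r set \<Rightarrow> nat \<Rightarrow> bool" where
  "koszul_acyclic A f G k \<longleftrightarrow>
     (\<forall>z. alternating z \<longrightarrow>
        (\<forall>xs. set xs \<subseteq> A \<longrightarrow> length xs = k \<longrightarrow> contract A f z xs \<in> G) \<longrightarrow>
        (\<exists>w. alternating w \<and>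
           (\<forall>xs. set xs \<subseteq> A \<longrightarrow> length xs = Suc k \<longrightarrow> z xs - contract A f w xs \<in> G)))"

lemma koszul_acyclic_above_card:
  fixes f :: "'i \<Rightarrow> 'r::comm_ring_1"
  assumes "is_ideal G" "finite A" "card A \<le> k"
  shows "koszul_acyclic A f G k"
  unfolding koszul_acyclic_def
proof (intro allI impI exI[of _ "\<lambda>_. 0"] conjI)
  fix z :: "'i list \<Rightarrow> 'r" and xs
  assume z: "alternating z" and xs: "set xs \<subseteq> A" "length xs = Suc k"
  have "\<not> distinct xs"
    using xs assms card_mono[OF assms(2) xs(1)] by (auto dest: distinct_card)
  then show "z xs - contract A f (\<lambda>_. 0) xs \<in> G"
    using alternating_repeated[OF z] by (simp add: contract_def ideal_0[OF assms(1)])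
qed (simp add: alternating_def)

text \<open>
  The surjection from \<open>H\<^sub>k\<^sub>+\<^sub>2\<close> over \<open>R / G'\<close> to \<open>H\<^sub>k\<^sub>+\<^sub>1\<close> over \<open>R / G\<close>, for \<open>G' = G + (g)\<close> with \<open>g\<close> in the ideal
  of \<open>f\<close> and a nonzerodivisor modulo \<open>G\<close>.  If \<open>z\<close> is a cycle modulo \<open>G\<close>, then \<open>c \<and> z\<close> is a cycle
  modulo \<open>G'\<close> by the homotopy, hence \<open>c \<and> z = \<partial>w + g u\<close> modulo \<open>G\<close>.  Applying \<open>\<partial>\<close> gives
  \<open>g z = g \<partial>u\<close> modulo \<open>G\<close>, and \<open>g\<close> cancels.  The quotient \<open>u\<close> must again be alternating; to this end
  the division by \<open>g\<close> modulo \<open>G\<close> is assumed to be given by an additive function.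
\<close>

lemma koszul_acyclic_step:
  fixes f :: "'i \<Rightarrow> 'r::comm_ring_1"
  assumes fin: "finite A" and G: "is_ideal G" and G': "is_ideal G'" "G \<subseteq> G'"
    and g: "g = (\<Sum>j\<in>A. f j * c j)" "g \<in> G'"
    and nzd: "\<And>p. g * p \<in> G \<Longrightarrow> p \<in> G"
    and quot_add: "\<And>p p'. quot (p + p') = quot p + quot p'"
    and quot: "\<And>p. p \<in> G' \<Longrightarrow> p - g * quot p \<in> G"
    and acyclic: "koszul_acyclic A f G' (Suc k)"
  shows "koszul_acyclic A f G k"
  unfolding koszul_acyclic_def
proof (intro allI impI)
  fix z :: "'i list \<Rightarrow> 'r"
  assume z: "alternating z"
    and cycle: "\<forall>xs. set xs \<subseteq> A \<longrightarrow> length xs = k \<longrightarrow> contract A f z xs \<in> G"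
  \<comment> \<open>The error term of the homotopy lies in \<open>G\<close>, because \<open>z\<close> is a cycle modulo \<open>G\<close>.\<close>
  have wedge_G: "wedge c (contract A f z) xs \<in> G" if "set xs \<subseteq> A" "length xs = Suc k" for xs
    using cycle that by (intro wedge_in_ideal[OF G, where A = A]) auto
  have homotopy: "contract A f (wedge c z) xs = g * z xs - wedge c (contract A f z) xs" for xs
    by (simp add: contract_wedge g(1))
  have "contract A f (wedge c z) xs \<in> G'" if "set xs \<subseteq> A" "length xs = Suc k" for xs
    unfolding homotopy using wedge_G[OF that] g(2) G'
    by (metis mult.commute ideal_diff ideal_scale subsetD)
  then obtain w where w: "alternating w"
    and bd: "\<And>xs. set xs \<subseteq> A \<Longrightarrow> length xs = Suc (Suc k) \<Longrightarrow> wedge c z xs - contract A f w xs \<in> G'"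
    using acyclic alternating_wedge[OF z] unfolding koszul_acyclic_def by metis
  define v where "v xs = wedge c z xs - contract A f w xs" for xs
  have v: "alternating v"
    unfolding v_def by (intro alternating_diff alternating_wedge z alternating_contract w)
  have quot_0: "quot 0 = 0"
    using quot_add[of 0 0] by simp
  have quot_minus: "quot (- p) = - quot p" for p
    using quot_add[of p "- p"] quot_0 by (simp add: eq_neg_iff_add_eq_0 add.commute)
  have u: "alternating (\<lambda>xs. quot (v xs))"
    unfolding alternating_def
  proof (intro conjI allI)
    fix us x y vs
    show "quot (v (us @ x # y # vs)) = - quot (v (us @ y # x # vs))"
      by (simp only: alternatingD(1)[OF v, of us x y vs] quot_minus)
    show "quot (v (us @ x # x # vs)) = 0"
      by (simp only: alternatingD(2)[OF v] quot_0)
  qed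
  have "z xs - contract A f (\<lambda>ys. quot (v ys)) xs \<in> G" if xs: "set xs \<subseteq> A" "length xs = Suc k" for xs
  proof (rule nzd)
    have "contract A f v xs = contract A f (wedge c z) xs - contract A f (contract A f w) xs"
      by (simp add: contract_def v_def right_diff_distrib sum_subtractf)
    then have "g * z xs = contract A f v xs + wedge c (contract A f z) xs"
      by (simp add: homotopy contract_contract[OF fin w])
    then have "g * (z xs - contract A f (\<lambda>ys. quot (v ys)) xs) =
        (\<Sum>j\<in>A. f j * (v (j # xs) - g * quot (v (j # xs)))) + wedge c (contract A f z) xs"
      by (simp add: contract_def right_diff_distrib sum_subtractf sum_distrib_left mult.left_commute)
    moreover have "v (j # xs) - g * quot (v (j # xs)) \<in> G" if "j \<in> A" for j
      using bd[of "j # xs"] xs that by (intro quot) (simp add: v_def)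
    ultimately show "g * (z xs - contract A f (\<lambda>ys. quot (v ys)) xs) \<in> G"
      using wedge_G[OF xs] G
      by (simp add: ideal_add ideal_sum ideal_scale)
  qed
  with u show "\<exists>w. alternating w \<and>
      (\<forall>xs. set xs \<subseteq> A \<longrightarrow> length xs = Suc k \<longrightarrow> z xs - contract A f w xs \<in> G)"
    by blast
qed


section \<open>Polynomials and their monomials\<close>

lemma sum_single_lookup:
  "(\<Sum>m\<in>Poly_Mapping.keys f. Poly_Mapping.single m (Poly_Mapping.lookup f m)) = f"
  by (rule poly_mapping_eqI)
     (auto simp: lookup_sum lookup_single when_def in_keys_iff)

lemma lookup_single_mult:
  fixes p :: "('v, 'c::comm_ring_1) mpol"
  shows "Poly_Mapping.lookup (Poly_Mapping.single t c * p) (t + m) = c * Poly_Mapping.lookup p m"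
proof -
  have "Poly_Mapping.lookup (Poly_Mapping.single t c * p) (t + m) =
      (\<Sum>n\<in>Poly_Mapping.keys p. c * Poly_Mapping.lookup p n when t + n = t + m)"
    by (subst (1) sum_single_lookup[of p, symmetric])
       (simp add: sum_distrib_left mult_single lookup_sum lookup_single)
  also have "\<dots> = c * Poly_Mapping.lookup p m"
    by (simp add: when_def in_keys_iff)
  finally show ?thesis .
qed

lemma lookup_Cst_mult:
  "Poly_Mapping.lookup (Cst c * f) m = c * Poly_Mapping.lookup (f :: ('v, 'c::comm_ring_1) mpol) m"
  using lookup_single_mult[of 0 c f m] by (simp add: Cst_def)

lemma Cst_mult: "Cst c * Cst d = (Cst (c * d) :: ('v, 'c::comm_ring_1) mpol)"
  by (simp add: Cst_def mult_single)

lemma Cst_sum: "Cst (\<Sum>i\<in>A. c i) = (\<Sum>i\<in>A. Cst (c i) :: ('v, 'c::comm_ring_1) mpol)"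
  by (induction A rule: infinite_finite_induct) (simp_all add: Cst_def single_add)

lemma Var_power: "Var v ^ n = (Poly_Mapping.single (Poly_Mapping.single v n) 1 :: ('v, 'c::comm_ring_1) mpol)"
  by (induction n) (simp_all add: Var_def mult_single flip: single_add)

lemma homogeneous_iff:
  "homogeneous d f \<longleftrightarrow>
     (\<forall>m. Poly_Mapping.lookup f m \<noteq> 0 \<longrightarrow> (\<Sum>i\<in>UNIV. Poly_Mapping.lookup m i) = d)"
  unfolding homogeneous_def by (auto simp: in_keys_iff)

lemma homogeneous_add: "homogeneous d f \<Longrightarrow> homogeneous d g \<Longrightarrow> homogeneous d (f + g)"
  unfolding homogeneous_iff lookup_add by (metis add_0)

lemma homogeneous_0: "homogeneous d 0"
  by (simp add: homogeneous_def)

lemma homogeneous_sum: "(\<And>i. i \<in> A \<Longrightarrow> homogeneous d (f i)) \<Longrightarrow> homogeneous d (sum f A)"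
  by (induction A rule: infinite_finite_induct) (auto intro: homogeneous_add homogeneous_0)

lemma homogeneous_Cst_mult:
  fixes f :: "('v::finite, 'c::comm_ring_1) mpol"
  shows "homogeneous d f \<Longrightarrow> homogeneous d (Cst c * f)"
  unfolding homogeneous_iff lookup_Cst_mult by (metis mult_zero_right)

lemma homogeneous_single:
  "(\<Sum>i\<in>UNIV. Poly_Mapping.lookup m i) = d \<Longrightarrow> homogeneous d (Poly_Mapping.single m c)"
  by (simp add: homogeneous_def)

lemma homogeneous_Var: "homogeneous 1 (Var i)"
  unfolding Var_def
  by (rule homogeneous_single) (simp add: lookup_single when_def)

lemma homogeneous_diff:
  fixes f g :: "('v::finite, 'c::comm_ring_1) mpol"
  assumes "homogeneous d f" "homogeneous d g"
  shows "homogeneous d (f - g)"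
proof -
  have "Cst (- 1) * g = - g"
    by (rule poly_mapping_eqI) (simp add: lookup_Cst_mult)
  then show ?thesis
    using homogeneous_add[OF assms(1) homogeneous_Cst_mult[OF assms(2), of "- 1"]] by simp
qed

lemma monomial_in_one_variable:
  fixes m :: "'v::finite \<Rightarrow>\<^sub>0 nat"
  assumes "\<And>j. j \<noteq> i \<Longrightarrow> Poly_Mapping.lookup m j = 0" "(\<Sum>j\<in>UNIV. Poly_Mapping.lookup m j) = d"
  shows "m = Poly_Mapping.single i d"
proof -
  have "Poly_Mapping.lookup m i = d"
    using sum.remove[of UNIV i "Poly_Mapping.lookup m"] assms by simp
  then show ?thesis
    using assms(1) by (intro poly_mapping_eqI) (auto simp: lookup_single when_def)
qed


section \<open>Syzygies of a system of parameters\<close>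

text \<open>
  The ideal generated by the powers \<open>x\<^sub>v ^ N v\<close> for \<open>v\<close> in \<open>V\<close>, described by its monomials; this
  turns regularity of the sequence of powers into a statement about exponents.
\<close>

definition powers_ideal :: "('v \<Rightarrow> nat) \<Rightarrow> 'v set \<Rightarrow> ('v, 'c::comm_ring_1) mpol set" where
  "powers_ideal N V = {p. \<forall>m\<in>Poly_Mapping.keys p. \<exists>v\<in>V. N v \<le> Poly_Mapping.lookup m v}"

lemma ideal_powers_ideal: "is_ideal (powers_ideal N V :: ('v, 'c::comm_ring_1) mpol set)"
proof (rule module.subspaceI[OF module_mult])
  show "0 \<in> (powers_ideal N V :: ('v, 'c) mpol set)"
    by (simp add: powers_ideal_def)
next
  fix p q :: "('v, 'c) mpol"
  assume "p \<in> powers_ideal N V" "q \<in> powers_ideal N V"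
  then show "p + q \<in> powers_ideal N V"
    using keys_add[of p q] unfolding powers_ideal_def by blast
next
  fix c p :: "('v, 'c) mpol"
  assume p: "p \<in> powers_ideal N V"
  show "c * p \<in> powers_ideal N V"
    unfolding powers_ideal_def
  proof (intro CollectI ballI)
    fix m assume "m \<in> Poly_Mapping.keys (c * p)"
    then obtain a b where m: "m = a + b" and "b \<in> Poly_Mapping.keys p"
      using keys_mult[of c p] by blast
    then obtain v where "v \<in> V" "N v \<le> Poly_Mapping.lookup b v"
      using p unfolding powers_ideal_def by blast
    then show "\<exists>v\<in>V. N v \<le> Poly_Mapping.lookup m v"
      by (auto simp: m lookup_add intro: trans_le_add2)
  qed
qed

text \<open>
  Multiplication by \<open>x\<^sub>v ^ n\<close> changes only the exponent of \<open>x\<^sub>v\<close>, on which membership does not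
  depend for \<open>v \<notin> V\<close>.
\<close>

lemma Var_power_nzd:
  fixes p :: "('v, 'c::comm_ring_1) mpol"
  assumes v: "v \<notin> V" and mem: "Var v ^ n * p \<in> powers_ideal N V"
  shows "p \<in> powers_ideal N V"
  unfolding powers_ideal_def
proof (intro CollectI ballI)
  fix m assume "m \<in> Poly_Mapping.keys p"
  then have "Poly_Mapping.single v n + m \<in> Poly_Mapping.keys (Var v ^ n * p)"
    by (simp add: in_keys_iff Var_power lookup_single_mult)
  then obtain u where "u \<in> V" "N u \<le> Poly_Mapping.lookup (Poly_Mapping.single v n + m) u"
    using mem unfolding powers_ideal_def by blast
  then show "\<exists>u\<in>V. N u \<le> Poly_Mapping.lookup m u"
    using v by (intro bexI[of _ u]) (auto simp: lookup_add lookup_single when_def split: if_splits)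
qed

text \<open>
  The quotient of the division by \<open>x\<^sub>v ^ n\<close>: the monomials not divisible by this power are
  dropped.  Reading it off the coefficients makes it additive.
\<close>

definition div_Var_power :: "'v \<Rightarrow> nat \<Rightarrow> ('v, 'c::comm_ring_1) mpol \<Rightarrow> ('v, 'c) mpol" where
  "div_Var_power v n = Poly_Mapping.map_key (\<lambda>m. Poly_Mapping.single v n + m)"

lemma lookup_div_Var_power:
  "Poly_Mapping.lookup (div_Var_power v n p) m = Poly_Mapping.lookup p (Poly_Mapping.single v n + m)"
proof -
  have "inj (\<lambda>m. Poly_Mapping.single v n + m)" by (rule injI) simp
  then show ?thesis by (simp add: div_Var_power_def map_key.rep_eq)
qed

lemma div_Var_power_add: "div_Var_power v n (p + q) = div_Var_power v n p + div_Var_power v n q"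
  by (rule poly_mapping_eqI) (simp add: lookup_div_Var_power lookup_add)

lemma Var_power_division:
  fixes p :: "('v, 'c::comm_ring_1) mpol"
  assumes "p \<in> powers_ideal N (insert v V)"
  shows "p - Var v ^ N v * div_Var_power v (N v) p \<in> powers_ideal N V"
  unfolding powers_ideal_def
proof (intro CollectI ballI)
  let ?t = "Poly_Mapping.single v (N v)"
  let ?r = "Var v ^ N v * div_Var_power v (N v) p"
  fix m assume m: "m \<in> Poly_Mapping.keys (p - ?r)"
  have less: "Poly_Mapping.lookup m v < N v"
  proof (rule ccontr)
    assume "\<not> Poly_Mapping.lookup m v < N v"
    then have "m = ?t + (m - ?t)"
      by (intro poly_mapping_eqI) (auto simp: lookup_add lookup_minus lookup_single when_def)
    then have "Poly_Mapping.lookup ?r m = Poly_Mapping.lookup p m"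
      by (metis Var_power lookup_single_mult lookup_div_Var_power mult_1)
    with m show False by (simp add: in_keys_iff lookup_minus)
  qed
  have "m \<notin> Poly_Mapping.keys ?r"
  proof
    assume "m \<in> Poly_Mapping.keys ?r"
    then obtain b where "m = ?t + b"
      using keys_mult[of "Var v ^ N v" "div_Var_power v (N v) p"] by (auto simp: Var_power)
    with less show False by (simp add: lookup_add)
  qed
  with m have "m \<in> Poly_Mapping.keys p" by (auto simp: in_keys_iff lookup_minus)
  with assms less show "\<exists>u\<in>V. N u \<le> Poly_Mapping.lookup m u"
    unfolding powers_ideal_def by fastforce
qed

text \<open>
  Induction on the number of variables outside \<open>V\<close>.  For \<open>V = UNIV\<close> the degree \<open>card V + 1\<close> exceeds the
  number of elements \<open>f\<close>, and taking a variable out of \<open>V\<close> lowers the degree by one.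
\<close>

lemma koszul_acyclic_powers_ideal:
  fixes f :: "'i \<Rightarrow> ('v::finite, 'c::comm_ring_1) mpol"
  assumes A: "finite A" "card A \<le> CARD('v)"
    and powers: "\<And>v. \<exists>c. Var v ^ N v = (\<Sum>j\<in>A. f j * c j)"
  shows "koszul_acyclic A f (powers_ideal N V) (card V)"
proof (induction "card (UNIV - V)" arbitrary: V)
  case 0
  then have "V = UNIV" by auto
  then show ?case
    using koszul_acyclic_above_card[OF ideal_powers_ideal A(1)] A(2) by blast
next
  case (Suc n)
  then have "V \<noteq> UNIV" by auto
  then obtain v where v: "v \<notin> V" by blast
  obtain c where c: "Var v ^ N v = (\<Sum>j\<in>A. f j * c j)" using powers[of v] ..
  have "card (UNIV - V - {v}) = card (UNIV - V) - 1"
    using v by (intro card_Diff_singleton) simp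
  then have card_n: "n = card (UNIV - insert v V)"
    by (simp only: Suc(2)[symmetric] Diff_insert[of UNIV v V] diff_Suc_1)
  have "card (insert v V) = Suc (card V)"
    using v by simp
  then have IH: "koszul_acyclic A f (powers_ideal N (insert v V)) (Suc (card V))"
    using Suc(1)[OF card_n] by simp
  show ?case
  proof (rule koszul_acyclic_step[OF A(1) ideal_powers_ideal ideal_powers_ideal _ c _ _ _ _ IH])
    show "powers_ideal N V \<subseteq> (powers_ideal N (insert v V) :: ('v, 'c) mpol set)"
      by (auto simp: powers_ideal_def)
    show "Var v ^ N v \<in> (powers_ideal N (insert v V) :: ('v, 'c) mpol set)"
      by (simp add: powers_ideal_def Var_power)
    show "p \<in> powers_ideal N V" if "Var v ^ N v * p \<in> powers_ideal N V" for p :: "('v, 'c) mpol"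
      using Var_power_nzd[OF v that] .
  qed (rule div_Var_power_add Var_power_division, assumption?)+
qed

text \<open>
  This is the vanishing of \<open>H\<^sub>1\<close>, the case \<open>V = {}\<close> of \<open>koszul_acyclic_powers_ideal\<close>, in terms of the
  coefficients: 2-chains become alternating matrices \<open>K\<close>.
\<close>

lemma syzygies_of_system_of_parameters:
  fixes f :: "'i \<Rightarrow> ('v::finite, 'c::comm_ring_1) mpol"
  assumes A: "finite A" "card A \<le> CARD('v)"
    and powers: "\<And>v. \<exists>n c. Var v ^ n = (\<Sum>j\<in>A. f j * c j)"
    and syz: "(\<Sum>j\<in>A. f j * z j) = 0"
  obtains K where "\<And>i j. K i j = - K j i" "\<And>i. K i i = 0" "\<And>i. i \<in> A \<Longrightarrow> z i = (\<Sum>j\<in>A. f j * K j i)"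
proof -
  obtain N where N: "\<And>v. \<exists>c. Var v ^ N v = (\<Sum>j\<in>A. f j * c j)"
    using powers by metis
  have zero: "powers_ideal N {} = ({0} :: ('v, 'c) mpol set)"
    by (auto simp: powers_ideal_def)
  have acyclic: "koszul_acyclic A f {0} 0"
    using koszul_acyclic_powers_ideal[OF A N, of "{}"] by (simp add: zero)
  \<comment> \<open>The syzygy as a 1-chain.\<close>
  define z' where "z' xs = (case xs of [i] \<Rightarrow> z i | _ \<Rightarrow> 0)" for xs
  have "alternating z'"
    unfolding alternating_def z'_def by (auto split: list.splits simp: append_eq_Cons_conv)
  moreover have "contract A f z' [] = 0"
    by (simp add: contract_def z'_def syz)
  ultimately obtain w where w: "alternating w"
    and bd: "\<And>xs. set xs \<subseteq> A \<Longrightarrow> length xs = Suc 0 \<Longrightarrow> z' xs - contract A f w xs \<in> {0}"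
    using acyclic unfolding koszul_acyclic_def by (metis length_0_conv singletonI)
  show thesis
  proof (rule that[of "\<lambda>j i. w [j, i]"])
    show "w [i, j] = - w [j, i]" "w [i, i] = 0" for i j
      by (rule alternating_Nil[OF w])+
    show "z i = (\<Sum>j\<in>A. f j * w [j, i])" if "i \<in> A" for i
      using bd[of "[i]"] that by (simp add: z'_def contract_def)
  qed
qed


section \<open>Powers of the variables in a reduction\<close>

lemma ideal_span_image:
  fixes f :: "'i \<Rightarrow> 'r::comm_ring_1"
  assumes "finite A" "x \<in> ideal_span (f ` A)"
  obtains c where "x = (\<Sum>j\<in>A. f j * c j)"
proof -
  have "is_ideal {x. \<exists>c. x = (\<Sum>j\<in>A. f j * c j)}"
  proof (rule module.subspaceI[OF module_mult])
    show "0 \<in> {x. \<exists>c. x = (\<Sum>j\<in>A. f j * c j)}"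
      by (auto intro: exI[of _ "\<lambda>_. 0"])
  next
    fix x y assume "x \<in> {x. \<exists>c. x = (\<Sum>j\<in>A. f j * c j)}" "y \<in> {x. \<exists>c. x = (\<Sum>j\<in>A. f j * c j)}"
    then obtain c d where "x = (\<Sum>j\<in>A. f j * c j)" "y = (\<Sum>j\<in>A. f j * d j)" by blast
    then have "x + y = (\<Sum>j\<in>A. f j * (c j + d j))"
      by (simp add: distrib_left sum.distrib)
    then show "x + y \<in> {x. \<exists>c. x = (\<Sum>j\<in>A. f j * c j)}"
      by (intro CollectI exI[of _ "\<lambda>j. c j + d j"])
  next
    fix r x assume "x \<in> {x. \<exists>c. x = (\<Sum>j\<in>A. f j * c j)}"
    then obtain c where "x = (\<Sum>j\<in>A. f j * c j)" by blast
    then have "r * x = (\<Sum>j\<in>A. f j * (r * c j))"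
      by (simp add: sum_distrib_left mult.left_commute)
    then show "r * x \<in> {x. \<exists>c. x = (\<Sum>j\<in>A. f j * c j)}"
      by (intro CollectI exI[of _ "\<lambda>j. r * c j"])
  qed
  moreover have "f ` A \<subseteq> {x. \<exists>c. x = (\<Sum>j\<in>A. f j * c j)}"
  proof clarify
    fix i assume "i \<in> A"
    then have "f i = (\<Sum>j\<in>A. f j * (if j = i then 1 else 0))"
      using assms(1) by (simp add: if_distrib[of "\<lambda>c. _ * c"] cong: if_cong)
    then show "\<exists>c. f i = (\<Sum>j\<in>A. f j * c j)"
      by (rule exI[of _ "\<lambda>j. if j = i then 1 else 0"])
  qed
  ultimately have "ideal_span (f ` A) \<subseteq> {x. \<exists>c. x = (\<Sum>j\<in>A. f j * c j)}"
    by (intro module.span_minimal[OF module_mult])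
  with assms(2) that show thesis by blast
qed

lemma power_in_ideal_power:
  assumes "x \<in> A"
  shows "x ^ n \<in> ideal_power A n"
proof (induction n)
  case (Suc n)
  with assms show ?case
    unfolding ideal_power.simps ideal_mult_def power_Suc
    by (intro module.span_base[OF module_mult]) blast
qed simp

lemma ideal_mult_subset_left:
  assumes "is_ideal A"
  shows "ideal_mult A B \<subseteq> A"
  unfolding ideal_mult_def
proof (rule module.span_minimal[OF module_mult _ assms])
  show "{a * b |a b. a \<in> A \<and> b \<in> B} \<subseteq> A"
    using ideal_scale[OF assms] by (auto simp: mult.commute)
qed

text \<open>
  If \<open>x ^ n \<in> I\<close> and \<open>I ^ (q + 1) = J I ^ q\<close>, then \<open>x ^ (n (q + 1)) \<in> J\<close>.
\<close>

lemma radical_reduction: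
  assumes "reduction J I"
  shows "radical I \<subseteq> radical J"
proof
  fix x assume "x \<in> radical I"
  then obtain n where "x ^ n \<in> I" by (auto simp: radical_def)
  moreover obtain q where "is_ideal J" "ideal_power I (q + 1) = ideal_mult J (ideal_power I q)"
    using assms unfolding reduction_def by blast
  ultimately have "(x ^ n) ^ (q + 1) \<in> J"
    using power_in_ideal_power[of "x ^ n" I "q + 1"] ideal_mult_subset_left by auto
  then show "x \<in> radical J"
    unfolding radical_def by (metis (mono_tags, lifting) mem_Collect_eq power_mult)
qed


section \<open>The Rees map\<close>

text \<open>
  The Rees map is a ring homomorphism that takes forms of degree \<open>d\<close> to multiples of \<open>t ^ d\<close>.
  It is used in two ways: over \<open>R\<close>, to recognise relations, and over \<open>k\<close>, followed by
  \<open>t \<mapsto> 1\<close>, as evaluation at a point.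
\<close>

lemma prod_monom: "(\<Prod>i\<in>A. monom (b i) (n i)) = monom (\<Prod>i\<in>A. b i) (\<Sum>i\<in>A. n i)"
  by (induction A rule: infinite_finite_induct) (simp_all add: mult_monom)

lemma rees_map_single:
  fixes a :: "'r::comm_ring_1 ^ 'm"
  shows "rees_map a (Poly_Mapping.single m c) =
    monom (c * (\<Prod>i\<in>UNIV. a $ i ^ Poly_Mapping.lookup m i)) (\<Sum>i\<in>UNIV. Poly_Mapping.lookup m i)"
  by (simp add: rees_map_def monom_power prod_monom smult_monom)

lemma rees_map_add: "rees_map a (f + g) = rees_map a f + rees_map a g"
  unfolding rees_map_def
  by (rule setsum_keys_plus_distrib[of "\<lambda>m c. [:c:] * (\<Prod>i\<in>UNIV. monom (a $ i) 1 ^ Poly_Mapping.lookup m i)"])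
     (simp_all add: smult_add_left)

lemma rees_map_0: "rees_map a 0 = 0"
  by (simp add: rees_map_def)

lemma rees_map_sum: "rees_map a (\<Sum>i\<in>A. f i) = (\<Sum>i\<in>A. rees_map a (f i))"
  by (induction A rule: infinite_finite_induct) (simp_all add: rees_map_0 rees_map_add)

lemma rees_map_mult:
  fixes f g :: "('m::finite, 'r::comm_ring_1) mpol"
  shows "rees_map a (f * g) = rees_map a f * rees_map a g"
proof -
  have single: "rees_map a (Poly_Mapping.single m c * Poly_Mapping.single n d) =
      rees_map a (Poly_Mapping.single m c) * rees_map a (Poly_Mapping.single n d)" for m n and c d :: 'r
    by (simp add: mult_single rees_map_single mult_monom lookup_add power_add prod.distrib
        sum.distrib ac_simps)
  have "rees_map a ((\<Sum>m\<in>Poly_Mapping.keys f. Poly_Mapping.single m (Poly_Mapping.lookup f m)) *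
        (\<Sum>m\<in>Poly_Mapping.keys g. Poly_Mapping.single m (Poly_Mapping.lookup g m))) =
      rees_map a (\<Sum>m\<in>Poly_Mapping.keys f. Poly_Mapping.single m (Poly_Mapping.lookup f m)) *
      rees_map a (\<Sum>m\<in>Poly_Mapping.keys g. Poly_Mapping.single m (Poly_Mapping.lookup g m))"
    by (simp only: sum_product rees_map_sum single)
  then show ?thesis by (simp only: sum_single_lookup)
qed

lemma rees_map_Cst: "rees_map a (Cst c) = [:c:]"
  by (simp add: Cst_def rees_map_single monom_0)

lemma rees_map_Var: "rees_map a (Var i) = monom (a $ i) 1"
proof -
  have "(\<Prod>j\<in>UNIV. a $ j ^ Poly_Mapping.lookup (Poly_Mapping.single i 1) j) =
      (\<Prod>j\<in>UNIV. if j = i then a $ j else 1)"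
    by (intro prod.cong) (auto simp: lookup_single when_def)
  moreover have "(\<Sum>j\<in>UNIV. Poly_Mapping.lookup (Poly_Mapping.single i (1::nat)) j) = 1"
    by (simp add: lookup_single when_def)
  ultimately show ?thesis by (simp add: Var_def rees_map_single)
qed

lemma rees_map_minus:
  fixes f :: "('m::finite, 'r::comm_ring_1) mpol"
  shows "rees_map a (- f) = - rees_map a f"
  using rees_map_add[of a f "- f"] by (simp add: rees_map_0 eq_neg_iff_add_eq_0 add.commute)

lemma rees_map_diff:
  fixes f g :: "('m::finite, 'r::comm_ring_1) mpol"
  shows "rees_map a (f - g) = rees_map a f - rees_map a g"
  using rees_map_add[of a f "- g"] by (simp add: rees_map_minus)

lemma sum_monom: "(\<Sum>i\<in>A. monom (b i) d) = monom (\<Sum>i\<in>A. b i) d"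
  by (induction A rule: infinite_finite_induct) (simp_all add: add_monom)

lemma rees_map_homogeneous:
  fixes f :: "('m::finite, 'r::comm_ring_1) mpol"
  assumes "homogeneous d f"
  shows "rees_map a f =
    monom (\<Sum>m\<in>Poly_Mapping.keys f. Poly_Mapping.lookup f m * (\<Prod>i\<in>UNIV. a $ i ^ Poly_Mapping.lookup m i)) d"
proof -
  have "rees_map a f = (\<Sum>m\<in>Poly_Mapping.keys f. rees_map a (Poly_Mapping.single m (Poly_Mapping.lookup f m)))"
    by (simp only: rees_map_sum[symmetric] sum_single_lookup)
  also have "\<dots> = (\<Sum>m\<in>Poly_Mapping.keys f.
      monom (Poly_Mapping.lookup f m * (\<Prod>i\<in>UNIV. a $ i ^ Poly_Mapping.lookup m i)) d)"
    using assms by (intro sum.cong refl) (simp add: rees_map_single homogeneous_def)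
  finally show ?thesis by (simp only: sum_monom)
qed

lemma rees_map_1:
  fixes a :: "'r::comm_ring_1 ^ 'm"
  shows "rees_map a 1 = 1"
  using rees_map_Cst[of a 1] by (simp add: Cst_def one_pCons)

lemma det_ring_hom:
  fixes A :: "'a::comm_ring_1 ^ 'n ^ 'n" and h :: "'a \<Rightarrow> 'b::comm_ring_1"
  assumes add: "\<And>x y. h (x + y) = h x + h y"
    and mult: "\<And>x y. h (x * y) = h x * h y" and one: "h 1 = 1"
  shows "det (\<chi> i j. h (A $ i $ j)) = h (det A)"
proof -
  have zero: "h 0 = 0"
    using add[of 0 0] by simp
  have minus: "h (- x) = - h x" for x
    using add[of x "- x"] by (simp add: zero eq_neg_iff_add_eq_0 add.commute)
  have sum: "h (\<Sum>i\<in>X. f i) = (\<Sum>i\<in>X. h (f i))" for X and f :: "('n \<Rightarrow> 'n) \<Rightarrow> 'a"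
    by (induction X rule: infinite_finite_induct) (simp_all add: zero add)
  have prod: "h (\<Prod>i\<in>X. f i) = (\<Prod>i\<in>X. h (f i))" for X and f :: "'n \<Rightarrow> 'a"
    by (induction X rule: infinite_finite_induct) (simp_all add: one mult)
  have sgn: "h (of_int (sign p)) = of_int (sign p)" for p :: "'n \<Rightarrow> 'n"
    by (cases p rule: sign_cases) (simp_all add: one minus)
  show ?thesis
    by (simp add: det_def sum mult prod sgn)
qed


section \<open>Quadratic relations and Koszul syzygies\<close>

text \<open>
  In every monomial of \<open>f\<close> a variable from \<open>A\<close> is chosen and split off.
\<close>

lemma homogeneous_Suc_decompose:
  fixes f :: "('m::finite, 'r::comm_ring_1) mpol"
  assumes hom: "homogeneous (Suc d) f"
    and A: "\<And>m. m \<in> Poly_Mapping.keys f \<Longrightarrow> \<exists>i\<in>A. Poly_Mapping.lookup m i \<noteq> 0"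
  shows "\<exists>p. f = (\<Sum>i\<in>A. Var i * p i) \<and> (\<forall>i. homogeneous d (p i))"
proof -
  obtain \<iota> where \<iota>: "\<And>m. m \<in> Poly_Mapping.keys f \<Longrightarrow> \<iota> m \<in> A"
      "\<And>m. m \<in> Poly_Mapping.keys f \<Longrightarrow> Poly_Mapping.lookup m (\<iota> m) \<noteq> 0"
    using A by metis
  define rest where "rest m = m - Poly_Mapping.single (\<iota> m) (1::nat)" for m
  have split: "m = Poly_Mapping.single (\<iota> m) 1 + rest m" if "m \<in> Poly_Mapping.keys f" for m
    using \<iota>(2)[OF that]
    by (intro poly_mapping_eqI) (auto simp: rest_def lookup_add lookup_minus lookup_single when_def)
  define p where
    "p i = (\<Sum>m\<in>{m\<in>Poly_Mapping.keys f. \<iota> m = i}. Poly_Mapping.single (rest m) (Poly_Mapping.lookup f m))"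
    for i
  have "(\<Sum>i\<in>A. Var i * p i) =
      (\<Sum>i\<in>A. \<Sum>m\<in>{m\<in>Poly_Mapping.keys f. \<iota> m = i}. Poly_Mapping.single m (Poly_Mapping.lookup f m))"
    unfolding p_def sum_distrib_left
  proof (intro sum.cong refl)
    fix i m assume "m \<in> {m \<in> Poly_Mapping.keys f. \<iota> m = i}"
    then show "Var i * Poly_Mapping.single (rest m) (Poly_Mapping.lookup f m) =
        Poly_Mapping.single m (Poly_Mapping.lookup f m)"
      using split[of m] by (simp add: Var_def mult_single)
  qed
  also have "\<dots> = f"
    using \<iota>(1) by (subst sum.group) (auto simp: sum_single_lookup)
  finally have "f = (\<Sum>i\<in>A. Var i * p i)" ..
  moreover have "homogeneous d (p i)" for i
    unfolding p_def
  proof (intro homogeneous_sum homogeneous_single)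
    fix m assume "m \<in> {m \<in> Poly_Mapping.keys f. \<iota> m = i}"
    then have m: "m \<in> Poly_Mapping.keys f" by simp
    have "Suc d = (\<Sum>j\<in>UNIV. Poly_Mapping.lookup m j)"
      using hom m by (simp add: homogeneous_def)
    also have "\<dots> = (\<Sum>j\<in>UNIV. Poly_Mapping.lookup (Poly_Mapping.single (\<iota> m) (1::nat)) j) +
        (\<Sum>j\<in>UNIV. Poly_Mapping.lookup (rest m) j)"
      unfolding sum.distrib[symmetric] lookup_add[symmetric] split[OF m, symmetric] ..
    finally show "(\<Sum>j\<in>UNIV. Poly_Mapping.lookup (rest m) j) = d"
      by (simp add: lookup_single when_def)
  qed
  ultimately show ?thesis by (intro exI[of _ p] conjI allI)
qed

text \<open>
  Here \<open>A\<close> is a set of indices whose entries of \<open>a\<close> have only Koszul syzygies, and \<open>f\<close> is a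
  quadratic relation in the ideal of the variables \<open>T\<^sub>i\<close> for \<open>i\<close> in \<open>A\<close>.  The coefficients of the
  Koszul syzygies correct the linear cofactors of these variables to linear relations.
\<close>

lemma quadric_in_S1L1:
  fixes a :: "'r::comm_ring_1 ^ 'm" and f :: "('m, 'r) mpol"
  assumes koszul: "\<And>b. (\<Sum>i\<in>A. a $ i * b i) = 0 \<Longrightarrow>
      \<exists>K. (\<forall>i j. K i j = - K j i) \<and> (\<forall>i. K i i = 0) \<and> (\<forall>i\<in>A. b i = (\<Sum>j\<in>A. a $ j * K j i))"
    and f: "f \<in> L_comp a 2"
    and A: "\<And>m. m \<in> Poly_Mapping.keys f \<Longrightarrow> \<exists>i\<in>A. Poly_Mapping.lookup m i \<noteq> 0"
  shows "f \<in> S1L1 a"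
proof -
  have hom: "homogeneous (Suc 1) f" and f0: "rees_map a f = 0"
    using f by (simp_all add: L_comp_def S_comp_def numeral_2_eq_2)
  obtain p where p: "f = (\<Sum>i\<in>A. Var i * p i)" "\<And>i. homogeneous 1 (p i)"
    using homogeneous_Suc_decompose[OF hom A] by iprover
  obtain b where b: "\<And>i. rees_map a (p i) = monom (b i) 1"
    using that[OF rees_map_homogeneous[OF p(2)]] .
  have "rees_map a f = monom (\<Sum>i\<in>A. a $ i * b i) 2"
    by (simp add: p(1) rees_map_sum rees_map_mult rees_map_Var b mult_monom sum_monom numeral_2_eq_2)
  then have "(\<Sum>i\<in>A. a $ i * b i) = 0"
    using f0 by simp
  from koszul[OF this] obtain K where K': "(\<forall>i j. K i j = - K j i) \<and> (\<forall>i. K i i = 0) \<and>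
      (\<forall>i\<in>A. b i = (\<Sum>j\<in>A. a $ j * K j i))" ..
  note K = K'[THEN conjunct1, rule_format] K'[THEN conjunct2, THEN conjunct1, rule_format]
    K'[THEN conjunct2, THEN conjunct2, rule_format]
  \<comment> \<open>The correction leaves \<open>f\<close> unchanged: the quadric formed with \<open>K\<close> vanishes.\<close>
  define l where "l i = p i - (\<Sum>j\<in>A. Cst (K j i) * Var j)" for i
  have l: "l i \<in> L_comp a 1" if "i \<in> A" for i
  proof -
    have "homogeneous 1 (l i)"
      unfolding l_def by (intro homogeneous_diff p(2) homogeneous_sum homogeneous_Cst_mult homogeneous_Var)
    moreover have "rees_map a (l i) = 0"
      by (simp add: l_def rees_map_diff rees_map_sum rees_map_mult rees_map_Cst rees_map_Var b
          smult_monom sum_monom K(3)[OF that] mult.commute)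
    ultimately show ?thesis by (simp add: L_comp_def S_comp_def)
  qed
  have "(\<Sum>i\<in>A. \<Sum>j\<in>A. Var i * Var j * Cst (K j i)) = (0 :: ('m, 'r) mpol)"
  proof (rule alternating_form_zero)
    show "Cst (K j i) = - (Cst (K i j) :: ('m, 'r) mpol)" for i j
      by (subst K(1)) (simp add: Cst_def single_uminus)
  qed (simp_all add: K(2) Cst_def)
  then have "f = (\<Sum>i\<in>A. Var i * l i)"
    by (simp add: l_def p(1) right_diff_distrib sum_subtractf sum_distrib_left ac_simps)
  moreover have "(\<Sum>i\<in>A. Var i * l i) \<in> S1L1 a"
    unfolding S1L1_def
  proof (intro module.span_sum[OF module_Cst_scale] module.span_base[OF module_Cst_scale])
    fix i assume "i \<in> A"
    then show "Var i * l i \<in> {s * l |s l. s \<in> S_comp 1 \<and> l \<in> L_comp a 1}"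
      using l homogeneous_Var[of i] by (auto simp: S_comp_def)
  qed
  ultimately show ?thesis by simp
qed


section \<open>The determinant\<close>

lemma exhaust_5:
  fixes x :: 5
  shows "x = 1 \<or> x = 2 \<or> x = 3 \<or> x = 4 \<or> x = 5"
proof (induct x)
  case (of_int z)
  then have "z = 0 \<or> z = 1 \<or> z = 2 \<or> z = 3 \<or> z = 4" by fastforce
  then show ?case by auto
qed

lemma lookup_kT_to_S:
  "Poly_Mapping.lookup (kT_to_S f) m = Cst (Poly_Mapping.lookup f m)"
  by (simp add: kT_to_S_def map.rep_eq when_def Cst_def)

lemma linear_form_zero:
  fixes c :: "'v::finite \<Rightarrow> 'k::comm_ring_1"
  assumes "(\<Sum>i\<in>UNIV. Var i * Cst (c i)) = (0 :: ('v, 'k) mpol)"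
  shows "c i = 0"
proof -
  have "Poly_Mapping.single i 1 = Poly_Mapping.single j (1::nat) \<longleftrightarrow> i = j" for j
    by (metis lookup_single_eq lookup_single_not_eq zero_neq_one)
  then have "Poly_Mapping.lookup (\<Sum>j\<in>UNIV. Var j * Cst (c j) :: ('v, 'k) mpol) (Poly_Mapping.single i 1) =
      (\<Sum>j\<in>UNIV. if i = j then c j else 0)"
    unfolding Var_def Cst_def mult_single lookup_sum lookup_single when_def
    by (intro sum.cong refl) (metis add.right_neutral mult_1)
  also have "\<dots> = c i"
    by simp
  finally have "Poly_Mapping.lookup (\<Sum>j\<in>UNIV. Var j * Cst (c j) :: ('v, 'k) mpol) (Poly_Mapping.single i 1) = c i" .
  then show ?thesis by (simp add: assms)
qed

theorem theorem5p1:
  fixes a :: "(4, 'k::field) mpol ^ 5"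
    and \<phi> :: "(4, 'k) mpol ^ 'n ^ 5"
    and q :: "(5, (4, 'k) mpol) mpol ^ 4"
    and B :: "(5, 'k) mpol ^ 4 ^ 4"
    and I J :: "(4, 'k) mpol set"
  assumes "I = ideal_span {a $ 1, a $ 2, a $ 3, a $ 4, a $ 5}"
    and "J = ideal_span {a $ 1, a $ 2, a $ 3, a $ 4}"
    and "\<forall>i. homogeneous 2 (a $ i)"
    and "minimally_generates (*) (\<lambda>i. a $ i) I"
    and "primary_to max_ideal I"
    and "minimal_reduction J I"
    and "minimal_graded_presentation a \<phi>"
    and "I1 \<phi> = ideal_power max_ideal 2"
    and "\<forall>j. q $ j \<in> L_comp a 2"
    and "\<forall>j m. homogeneous 1 (Poly_Mapping.lookup (q $ j) m)"
    and "minimally_generates_quotient Cst_scale (\<lambda>j. q $ j) (L_comp a 2) (S1L1 a)"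
    and "q = (\<chi> i. Cst (Var i)) v* (\<chi> i j. kT_to_S (B $ i $ j))"
  shows "det B \<noteq> 0"
proof -
  let ?A = "{1, 2, 3, 4} :: 5 set"
  let ?e = "Poly_Mapping.single (5::5) (2::nat)"
  define B0 :: "'k ^ 4 ^ 4" where "B0 = (\<chi> i j. Poly_Mapping.lookup (B $ i $ j) ?e)"
  have q: "q $ j = (\<Sum>i\<in>UNIV. Cst (Var i) * kT_to_S (B $ i $ j))" for j
    by (simp add: assms(12) vector_matrix_mult_def)
  have lookup_q: "Poly_Mapping.lookup (q $ j) m =
      (\<Sum>i\<in>UNIV. Var i * Cst (Poly_Mapping.lookup (B $ i $ j) m))" for j m
    by (simp add: q lookup_sum lookup_Cst_mult lookup_kT_to_S)
  have q_L: "homogeneous 2 (q $ j)" "rees_map a (q $ j) = 0" for j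
    using assms(9) by (auto simp: L_comp_def S_comp_def)

  \<comment> \<open>The first four entries of \<open>a\<close> form a system of parameters.\<close>
  have powers: "\<exists>n c. Var v ^ n = (\<Sum>j\<in>?A. a $ j * c j)" for v
  proof -
    have "Var v \<in> radical I"
      using assms(5) module.span_base[OF module_mult, of "Var v" "range Var"]
      by (simp add: primary_to_def max_ideal_def)
    then obtain n where "Var v ^ n \<in> J"
      using radical_reduction[of J I] assms(6) by (auto simp: minimal_reduction_def radical_def)
    moreover have "J = ideal_span ((\<lambda>j. a $ j) ` ?A)"
      by (simp add: assms(2))
    ultimately have "Var v ^ n \<in> ideal_span ((\<lambda>j. a $ j) ` ?A)" by simp
    from ideal_span_image[OF _ this] obtain c where "Var v ^ n = (\<Sum>j\<in>?A. a $ j * c j)"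
      by blast
    then show ?thesis by (intro exI)
  qed
  have koszul: "\<exists>K. (\<forall>i j. K i j = - K j i) \<and> (\<forall>i. K i i = 0) \<and> (\<forall>i\<in>?A. b i = (\<Sum>j\<in>?A. a $ j * K j i))"
    if "(\<Sum>i\<in>?A. a $ i * b i) = 0" for b
  proof -
    have "finite ?A" "card ?A \<le> CARD(4)" by simp_all
    then show ?thesis
    proof (rule syzygies_of_system_of_parameters[OF _ _ powers that])
      fix K
      assume K: "\<And>i j. K i j = - K j i" "\<And>i. K i i = 0" "\<And>i. i \<in> ?A \<Longrightarrow> b i = (\<Sum>j\<in>?A. a $ j * K j i)"
      show ?thesis by (rule exI[of _ K]) (intro conjI allI ballI K)
    qed
  qed

  \<comment> \<open>A kernel vector of \<open>B0\<close> gives a combination of the quadrics without \<open>T\<^sub>5\<^sup>2\<close>-term.\<close>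
  have "c = 0" if c: "B0 *v c = 0" for c
  proof (rule ccontr)
    assume "c \<noteq> 0"
    then obtain j where j: "c $ j \<noteq> 0" by (auto simp: vec_eq_iff)
    define f where "f = (\<Sum>j\<in>UNIV. Cst_scale (Cst (c $ j)) (q $ j))"
    have f_hom: "homogeneous 2 f"
      unfolding f_def Cst_scale_def by (intro homogeneous_sum homogeneous_Cst_mult q_L)
    have "rees_map a f = 0"
      by (simp add: f_def Cst_scale_def rees_map_sum rees_map_mult q_L)
    with f_hom have f_L: "f \<in> L_comp a 2"
      by (simp add: L_comp_def S_comp_def)
    have supp_A: "\<exists>i\<in>?A. Poly_Mapping.lookup m i \<noteq> 0" if m: "m \<in> Poly_Mapping.keys f" for m
    proof (rule ccontr)
      assume "\<not> ?thesis"
      then have supp: "Poly_Mapping.lookup m i = 0" if "i \<noteq> 5" for i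
        using exhaust_5[of i] that by auto
      have "(\<Sum>i\<in>UNIV. Poly_Mapping.lookup m i) = 2"
        using f_hom m by (simp add: homogeneous_def)
      then have "m = ?e"
        using supp by (intro monomial_in_one_variable)
      moreover have "Poly_Mapping.lookup f ?e = 0"
      proof -
        have "Poly_Mapping.lookup f ?e =
            (\<Sum>j\<in>UNIV. Cst (c $ j) * (\<Sum>i\<in>UNIV. Var i * Cst (B0 $ i $ j)))"
          by (simp add: f_def Cst_scale_def lookup_sum lookup_Cst_mult lookup_q B0_def)
        also have "\<dots> = (\<Sum>j\<in>UNIV. \<Sum>i\<in>UNIV. Var i * Cst (B0 $ i $ j * c $ j))"
          by (simp add: sum_distrib_left mult.left_commute Cst_mult mult.commute[of "c $ _"])
        also have "\<dots> = (\<Sum>i\<in>UNIV. Var i * Cst ((B0 *v c) $ i))"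
          by (subst sum.swap) (simp add: matrix_vector_mult_def Cst_sum sum_distrib_left)
        finally show ?thesis by (simp add: c Cst_def)
      qed
      ultimately show False using m by (simp add: in_keys_iff)
    qed
    have f_S1L1: "f \<in> S1L1 a"
      by (rule quadric_in_S1L1[OF _ f_L supp_A]) (rule koszul)
    let ?N = "module.span Cst_scale ((\<lambda>j. q $ j) ` (UNIV - {j}) \<union> S1L1 a)"
    have "f = Cst_scale (Cst (c $ j)) (q $ j) + (\<Sum>i\<in>UNIV - {j}. Cst_scale (Cst (c $ i)) (q $ i))"
      unfolding f_def by (rule sum.remove) simp_all
    then have "Cst_scale (Cst (c $ j)) (q $ j) =
        f - (\<Sum>i\<in>UNIV - {j}. Cst_scale (Cst (c $ i)) (q $ i))"
      by simp
    also have "\<dots> \<in> ?N"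
    proof (rule module.span_diff[OF module_Cst_scale])
      show "f \<in> ?N"
        by (rule module.span_base[OF module_Cst_scale UnI2[OF f_S1L1]])
      have "q $ i \<in> ?N" if "i \<in> UNIV - {j}" for i
        by (rule module.span_base[OF module_Cst_scale UnI1[OF imageI[OF that]]])
      then show "(\<Sum>i\<in>UNIV - {j}. Cst_scale (Cst (c $ i)) (q $ i)) \<in> ?N"
        by (intro module.span_sum[OF module_Cst_scale] module.span_scale[OF module_Cst_scale])
    qed
    finally have "Cst_scale (Cst (1 / c $ j)) (Cst_scale (Cst (c $ j)) (q $ j)) \<in> ?N"
      by (rule module.span_scale[OF module_Cst_scale])
    moreover have "Cst_scale (Cst (1 / c $ j)) (Cst_scale (Cst (c $ j)) (q $ j)) = q $ j"
      using j by (simp add: Cst_scale_def Cst_mult mult.assoc[symmetric]) (simp add: Cst_def)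
    ultimately have "q $ j \<in> ?N" by simp
    then show False
      using assms(11) unfolding minimally_generates_quotient_def by blast
  qed
  then have "det B0 \<noteq> 0"
    using matrix_left_invertible_ker[of B0] invertible_left_inverse[of B0] invertible_det_nz[of B0] by blast

  \<comment> \<open>The variables of \<open>R\<close> are linearly independent over \<open>k\<close>, so \<open>B\<close> inherits its degree from the quadrics.\<close>
  have B_hom: "homogeneous 2 (B $ i $ j)" for i j
    unfolding homogeneous_iff
  proof (intro allI impI)
    fix m assume "Poly_Mapping.lookup (B $ i $ j) m \<noteq> 0"
    then have "Poly_Mapping.lookup (q $ j) m \<noteq> 0"
      using linear_form_zero[of "\<lambda>i. Poly_Mapping.lookup (B $ i $ j) m"] by (auto simp: lookup_q)
    then show "(\<Sum>i\<in>UNIV. Poly_Mapping.lookup m i) = 2"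
      using q_L(1) unfolding homogeneous_iff by blast
  qed
  \<comment> \<open>At the point \<open>(0, 0, 0, 0, 1)\<close> a quadratic form takes its coefficient at \<open>T\<^sub>5\<^sup>2\<close> as value.\<close>
  have eval: "poly (rees_map (axis 5 1) (B $ i $ j)) 1 = B0 $ i $ j" for i j
  proof -
    have "(\<Prod>i\<in>UNIV. (axis 5 1 :: 'k ^ 5) $ i ^ Poly_Mapping.lookup m i) = (if m = ?e then 1 else 0)"
      if "m \<in> Poly_Mapping.keys (B $ i $ j)" for m
    proof (cases "m = ?e")
      case True
      have "(axis 5 1 :: 'k ^ 5) $ i ^ Poly_Mapping.lookup m i = 1" for i
        by (cases "i = 5") (simp_all add: True axis_def lookup_single_not_eq)
      with True show ?thesis by simp
    next
      case False
      have sum2: "(\<Sum>i\<in>UNIV. Poly_Mapping.lookup m i) = 2"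
        using B_hom that by (simp add: homogeneous_def)
      obtain i where "i \<noteq> 5" "Poly_Mapping.lookup m i \<noteq> 0"
        using monomial_in_one_variable[of 5 m, OF _ sum2] False by blast
      then have "(axis 5 1 :: 'k ^ 5) $ i ^ Poly_Mapping.lookup m i = 0"
        by (simp add: axis_def)
      then have "(\<Prod>i\<in>UNIV. (axis 5 1 :: 'k ^ 5) $ i ^ Poly_Mapping.lookup m i) = 0"
        by (intro prod_zero) auto
      with False show ?thesis by simp
    qed
    then have "(\<Sum>m\<in>Poly_Mapping.keys (B $ i $ j). Poly_Mapping.lookup (B $ i $ j) m *
        (\<Prod>i\<in>UNIV. (axis 5 1 :: 'k ^ 5) $ i ^ Poly_Mapping.lookup m i)) =
        (\<Sum>m\<in>Poly_Mapping.keys (B $ i $ j). if m = ?e then Poly_Mapping.lookup (B $ i $ j) m else 0)"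
      by (intro sum.cong) auto
    also have "\<dots> = B0 $ i $ j"
      by (simp add: B0_def in_keys_iff)
    finally show ?thesis
      by (simp add: rees_map_homogeneous[OF B_hom] poly_monom)
  qed
  have "det B0 = det (\<chi> i j. poly (rees_map (axis 5 1) (B $ i $ j)) 1)"
    by (simp add: eval)
  also have "\<dots> = poly (rees_map (axis 5 1) (det B)) 1"
    by (rule det_ring_hom) (simp_all add: rees_map_add rees_map_mult rees_map_1)
  finally show ?thesis
    using \<open>det B0 \<noteq> 0\<close> by (auto simp: rees_map_0)
qed

end
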